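(* Let $a=1+a_2\mathbf{j}+a_3\mathbf{k}$ with $a_2^2+a_3^2=1$, $b=b_1\mathbf{i}+b_2\mathbf{j}+b_3\mathbf{k}\neq0$ and $c$ be split quaternions (with $a_2,a_3,b_1,b_2,b_3\in\mathbb{R}$) such that $P_{ab}=0$, $I_b\neq0$ and $I_b+2P_{ac}\neq0$. Then $ax^2+bx+c=0$ is solvable in $\mathbb{H}_s$, and $$x=(Ta+b)^{-1}(aN-c),\qquad\text{where}\quad N=\frac{I_c}{I_b+2P_{ac}},\quad T=\frac{-2P_{bc}}{I_b+2P_{ac}},$$ is its solution.
   Context: $\mathbb{H}_s$ is the real algebra of split quaternions $x=x_0+x_1\mathbf{i}+x_2\mathbf{j}+x_3\mathbf{k}$ ($x_i\in\mathbb{R}$), with $\mathbf{i}^2=-1$, $\mathbf{j}^2=\mathbf{k}^2=1$, $\mathbf{i}\mathbf{j}=\mathbf{k}=-\mathbf{j}\mathbf{i}$, $\mathbf{j}\mathbf{k}=-\mathbf{i}=-\mathbf{k}\mathbf{j}$, $\mathbf{k}\mathbf{i}=\mathbf{j}=-\mathbf{i}\mathbf{k}$. Put $I_x=x_0^2+x_1^2-x_2^2-x_3^2$ and $P_{xy}=x_0y_0+x_1y_1-x_2y_2-x_3y_3$. An element $x$ is invertible if and only if $I_x\neq0$. (Under the hypotheses $P_{ab}=0$, $I_a=0$ one has $I_{ta+b}=I_b$ for every real $t$.) *)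

theory Defs
  imports Complex_Main
begin

section \<open>The real algebra of split quaternions\<close>

text \<open>\<open>SQuat x0 x1 x2 x3\<close> stands for \<open>x0 + x1 i + x2 j + x3 k\<close>.\<close>

datatype split_quat = SQuat (sq0: real) (sq1: real) (sq2: real) (sq3: real)

lemma split_quat_eq_iff:
  "x = y \<longleftrightarrow> sq0 x = sq0 y \<and> sq1 x = sq1 y \<and> sq2 x = sq2 y \<and> sq3 x = sq3 y"
  by (cases x; cases y) simp

instantiation split_quat :: real_algebra_1
begin

definition zero_split_quat :: split_quat where
  "0 = SQuat 0 0 0 0"

definition one_split_quat :: split_quat where
  "1 = SQuat 1 0 0 0"

definition plus_split_quat :: "split_quat \<Rightarrow> split_quat \<Rightarrow> split_quat" where
  "x + y = SQuat (sq0 x + sq0 y) (sq1 x + sq1 y) (sq2 x + sq2 y) (sq3 x + sq3 y)"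

definition minus_split_quat :: "split_quat \<Rightarrow> split_quat \<Rightarrow> split_quat" where
  "x - y = SQuat (sq0 x - sq0 y) (sq1 x - sq1 y) (sq2 x - sq2 y) (sq3 x - sq3 y)"

definition uminus_split_quat :: "split_quat \<Rightarrow> split_quat" where
  "- x = SQuat (- sq0 x) (- sq1 x) (- sq2 x) (- sq3 x)"

definition scaleR_split_quat :: "real \<Rightarrow> split_quat \<Rightarrow> split_quat" where
  "r *\<^sub>R x = SQuat (r * sq0 x) (r * sq1 x) (r * sq2 x) (r * sq3 x)"

text \<open>The product is the bilinear extension of the multiplication table of the units, which is
  recovered in \<open>sq_unit_mult\<close> below.\<close>

definition times_split_quat :: "split_quat \<Rightarrow> split_quat \<Rightarrow> split_quat" where
  "x * y = SQuat
     (sq0 x * sq0 y - sq1 x * sq1 y + sq2 x * sq2 y + sq3 x * sq3 y)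
     (sq0 x * sq1 y + sq1 x * sq0 y - sq2 x * sq3 y + sq3 x * sq2 y)
     (sq0 x * sq2 y + sq2 x * sq0 y - sq1 x * sq3 y + sq3 x * sq1 y)
     (sq0 x * sq3 y + sq3 x * sq0 y + sq1 x * sq2 y - sq2 x * sq1 y)"

instance
  by standard
    (simp_all add: split_quat_eq_iff zero_split_quat_def one_split_quat_def plus_split_quat_def
      minus_split_quat_def uminus_split_quat_def scaleR_split_quat_def times_split_quat_def
      algebra_simps)

end

definition sq_i :: split_quat where "sq_i = SQuat 0 1 0 0"
definition sq_j :: split_quat where "sq_j = SQuat 0 0 1 0"
definition sq_k :: split_quat where "sq_k = SQuat 0 0 0 1"

lemma sq_unit_mult:
  "sq_i * sq_i = - 1" "sq_j * sq_j = 1" "sq_k * sq_k = 1"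
  "sq_i * sq_j = sq_k" "sq_j * sq_i = - sq_k"
  "sq_j * sq_k = - sq_i" "sq_k * sq_j = sq_i"
  "sq_k * sq_i = sq_j" "sq_i * sq_k = - sq_j"
  by (simp_all add: sq_i_def sq_j_def sq_k_def one_split_quat_def uminus_split_quat_def
      times_split_quat_def)

lemma SQuat_eq_units:
  "SQuat x0 x1 x2 x3 = x0 *\<^sub>R 1 + x1 *\<^sub>R sq_i + x2 *\<^sub>R sq_j + x3 *\<^sub>R sq_k"
  by (simp add: sq_i_def sq_j_def sq_k_def one_split_quat_def plus_split_quat_def
      scaleR_split_quat_def)

definition sq_I :: "split_quat \<Rightarrow> real" where
  "sq_I x = (sq0 x)\<^sup>2 + (sq1 x)\<^sup>2 - (sq2 x)\<^sup>2 - (sq3 x)\<^sup>2"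

definition sq_P :: "split_quat \<Rightarrow> split_quat \<Rightarrow> real" where
  "sq_P x y = sq0 x * sq0 y + sq1 x * sq1 y - sq2 x * sq2 y - sq3 x * sq3 y"

definition sq_invertible :: "split_quat \<Rightarrow> bool" where
  "sq_invertible x \<longleftrightarrow> (\<exists>y. x * y = 1 \<and> y * x = 1)"

text \<open>The two-sided inverse; unspecified unless \<open>sq_invertible x\<close>.\<close>

definition sq_inverse :: "split_quat \<Rightarrow> split_quat" where
  "sq_inverse x = (THE y. x * y = 1 \<and> y * x = 1)"

end

theory Submission
  imports Defs
begin

text \<open>
  Every split quaternion satisfies its own real quadratic equation
  \<open>x\<^sup>2 = t x - n\<close> with trace \<open>t = 2 x\<^sub>0\<close> and norm \<open>n = I\<^sub>x\<close>
  (\<open>sq_power2_eq_trace_norm\<close>). This makes \<open>a x\<^sup>2 + b x + c = 0\<close> the linear equation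
  \<open>(t a + b) x = n a - c\<close>, whose coefficients still depend on \<open>x\<close>, but only through the two reals
  \<open>t\<close> and \<open>n\<close>. The element \<open>a\<close> is null and orthogonal to \<open>b\<close> for the quadratic form \<open>I\<close>, so
  \<open>I\<^bsub>ta+b\<^esub> = I\<^sub>b \<noteq> 0\<close>; hence \<open>t a + b\<close> is invertible whatever \<open>t\<close> is, and
  \<open>x = (t a + b)\<^sup>-\<^sup>1 (n a - c)\<close>.

  It remains to see which pairs \<open>(t, n)\<close> are consistent, that is, are the trace and the norm of this
  quotient. The norm is multiplicative and the trace of \<open>u\<^sup>-\<^sup>1 v\<close> is
  \<open>2 P\<^bsub>uv\<^esub> / I\<^sub>u\<close>. Since \<open>a\<close> is null and orthogonal to \<open>b\<close>, all terms of degree two in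
  \<open>(t, n)\<close> disappear, and the conditions decouple into
  \<open>(I\<^sub>b + 2 P\<^bsub>ac\<^esub>) n = I\<^sub>c\<close> and \<open>(I\<^sub>b + 2 P\<^bsub>ac\<^esub>) t = - 2 P\<^bsub>bc\<^esub>\<close>
  (\<open>norm_trace_consistent_iff\<close>). The only solution is \<open>(T, N)\<close>, so the displayed \<open>x\<close> is
  a solution and there is no other.
\<close>

lemmas split_quat_coords =
  split_quat_eq_iff zero_split_quat_def one_split_quat_def plus_split_quat_def
  minus_split_quat_def uminus_split_quat_def scaleR_split_quat_def times_split_quat_def

definition sq_conj :: "split_quat \<Rightarrow> split_quat" where
  "sq_conj x = SQuat (sq0 x) (- sq1 x) (- sq2 x) (- sq3 x)"

lemma sq_mult_conj: "x * sq_conj x = sq_I x *\<^sub>R 1"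
  by (simp add: split_quat_coords sq_conj_def sq_I_def power2_eq_square)

lemma sq_conj_mult: "sq_conj x * x = sq_I x *\<^sub>R 1"
  by (simp add: split_quat_coords sq_conj_def sq_I_def power2_eq_square)

lemma sq_I_mult: "sq_I (x * y) = sq_I x * sq_I y"
  by (simp add: times_split_quat_def sq_I_def power2_eq_square algebra_simps)

lemma sq_I_conj: "sq_I (sq_conj x) = sq_I x"
  by (simp add: sq_conj_def sq_I_def)

lemma sq_I_scaleR: "sq_I (r *\<^sub>R x) = r\<^sup>2 * sq_I x"
  by (simp add: scaleR_split_quat_def sq_I_def power_mult_distrib algebra_simps)

lemma sq0_scaleR: "sq0 (r *\<^sub>R x) = r * sq0 x"
  by (simp add: scaleR_split_quat_def)

lemma sq_I_lincomb:
  "sq_I (r *\<^sub>R x + s *\<^sub>R y) = r\<^sup>2 * sq_I x + 2 * r * s * sq_P x y + s\<^sup>2 * sq_I y"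
  by (simp add: scaleR_split_quat_def plus_split_quat_def sq_I_def sq_P_def
      power2_eq_square algebra_simps)

lemma sq_P_lincomb:
  "sq_P (r *\<^sub>R x + y) (s *\<^sub>R x - z)
    = r * s * sq_I x - r * sq_P x z + s * sq_P x y - sq_P y z"
  by (simp add: scaleR_split_quat_def plus_split_quat_def minus_split_quat_def sq_I_def sq_P_def
      power2_eq_square algebra_simps)

lemma sq0_conj_mult: "sq0 (sq_conj x * y) = sq_P x y"
  by (simp add: times_split_quat_def sq_conj_def sq_P_def)

text \<open>The Cayley--Hamilton identity when split quaternions are viewed as real \<open>2 \<times> 2\<close> matrices:
  the trace is \<open>2 x\<^sub>0\<close> and the determinant is \<open>I\<^sub>x\<close>.\<close>

lemma sq_power2_eq_trace_norm: "x\<^sup>2 = (2 * sq0 x) *\<^sub>R x - sq_I x *\<^sub>R 1"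
  by (simp add: power2_eq_square split_quat_coords sq_I_def algebra_simps)

lemma sq_inverse_unique:
  assumes "x * y = 1" and "y * x = 1"
  shows "sq_inverse x = y"
  unfolding sq_inverse_def
proof (rule the_equality)
  fix z assume "x * z = 1 \<and> z * x = 1"
  then show "z = y"
    using assms by (metis mult.assoc mult_1_left mult_1_right)
qed (use assms in simp)

lemma
  assumes "sq_I x \<noteq> 0"
  shows sq_inverse_eq_conj: "sq_inverse x = (1 / sq_I x) *\<^sub>R sq_conj x"
    and sq_mult_inverse: "x * sq_inverse x = 1"
    and sq_inverse_mult: "sq_inverse x * x = 1"
proof -
  have right: "x * ((1 / sq_I x) *\<^sub>R sq_conj x) = 1"
    and left: "((1 / sq_I x) *\<^sub>R sq_conj x) * x = 1"
    using assms by (simp_all add: sq_mult_conj sq_conj_mult)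
  show eq: "sq_inverse x = (1 / sq_I x) *\<^sub>R sq_conj x"
    by (rule sq_inverse_unique[OF right left])
  show "x * sq_inverse x = 1" "sq_inverse x * x = 1"
    unfolding eq by (fact right, fact left)
qed

lemma sq_invertible_if_norm_nonzero: "sq_I x \<noteq> 0 \<Longrightarrow> sq_invertible x"
  unfolding sq_invertible_def using sq_mult_inverse sq_inverse_mult by blast

lemma sq_mult_eq_iff:
  assumes "sq_I u \<noteq> 0"
  shows "u * x = v \<longleftrightarrow> x = sq_inverse u * v"
  using sq_mult_inverse[OF assms] sq_inverse_mult[OF assms]
  by (metis mult.assoc mult_1_left)

lemma sq_I_inverse_mult:
  assumes "sq_I u \<noteq> 0"
  shows "sq_I (sq_inverse u * v) = sq_I v / sq_I u"
  using assms
  by (simp add: sq_inverse_eq_conj sq_I_scaleR sq_I_mult sq_I_conj power2_eq_square)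

lemma sq0_inverse_mult:
  assumes "sq_I u \<noteq> 0"
  shows "sq0 (sq_inverse u * v) = sq_P u v / sq_I u"
  using assms sq0_conj_mult[of u v]
  by (simp add: sq_inverse_eq_conj sq0_scaleR)

lemma sq_I_scaleR_null_add:
  assumes "sq_I a = 0" and "sq_P a b = 0"
  shows "sq_I (t *\<^sub>R a + b) = sq_I b"
  using sq_I_lincomb[of t a 1 b] assms by simp

text \<open>The trace and norm of \<open>x\<close> are the only nonlinear data in the quadratic equation; once they are
  split off, the equation can be solved for \<open>x\<close> by division.\<close>

lemma quadratic_iff_quotient:
  assumes "sq_I a = 0" and "sq_P a b = 0" and "sq_I b \<noteq> 0"
  shows "a * x\<^sup>2 + b * x + c = 0 \<longleftrightarrow>
    x = sq_inverse ((2 * sq0 x) *\<^sub>R a + b) * (sq_I x *\<^sub>R a - c)"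
proof -
  let ?u = "(2 * sq0 x) *\<^sub>R a + b"
  have "a * x\<^sup>2 + b * x + c = ?u * x - (sq_I x *\<^sub>R a - c)"
    by (simp add: sq_power2_eq_trace_norm[of x] algebra_simps)
  then have "a * x\<^sup>2 + b * x + c = 0 \<longleftrightarrow> ?u * x = sq_I x *\<^sub>R a - c"
    by (simp only: right_minus_eq)
  also have "\<dots> \<longleftrightarrow> x = sq_inverse ?u * (sq_I x *\<^sub>R a - c)"
    by (rule sq_mult_eq_iff) (simp add: sq_I_scaleR_null_add assms)
  finally show ?thesis .
qed

text \<open>Nullity of \<open>a\<close> removes \<open>n\<^sup>2\<close> from the norm of \<open>n a - c\<close> and \<open>t n\<close> from
  \<open>P(t a + b, n a - c)\<close>, while orthogonality of \<open>a\<close> and \<open>b\<close> removes \<open>n\<close> from the latter and \<open>t\<close>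
  from the norm of the divisor. What is left is one linear equation for each unknown.\<close>

lemma norm_trace_consistent_iff:
  assumes null: "sq_I a = 0" and orth: "sq_P a b = 0" and Ib: "sq_I b \<noteq> 0"
    and denom: "sq_I b + 2 * sq_P a c \<noteq> 0"
  defines "q \<equiv> \<lambda>t n. sq_inverse (t *\<^sub>R a + b) * (n *\<^sub>R a - c)"
  shows "sq_I (q t n) = n \<longleftrightarrow> n = sq_I c / (sq_I b + 2 * sq_P a c)"
    and "2 * sq0 (q t n) = t \<longleftrightarrow> t = (- 2 * sq_P b c) / (sq_I b + 2 * sq_P a c)"
proof -
  have u: "sq_I (t *\<^sub>R a + b) = sq_I b"
    by (rule sq_I_scaleR_null_add[OF null orth])
  have "sq_I (n *\<^sub>R a - c) = sq_I c - 2 * n * sq_P a c"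
    using sq_I_lincomb[of n a "- 1" c] null by simp
  then have "sq_I (q t n) = (sq_I c - 2 * n * sq_P a c) / sq_I b"
    using Ib by (simp add: q_def sq_I_inverse_mult u)
  then have "sq_I (q t n) = n \<longleftrightarrow> n * (sq_I b + 2 * sq_P a c) = sq_I c"
    using Ib by (auto simp: divide_eq_eq algebra_simps)
  then show "sq_I (q t n) = n \<longleftrightarrow> n = sq_I c / (sq_I b + 2 * sq_P a c)"
    using denom by (simp only: eq_divide_eq simp_thms if_True)
  have "sq_P (t *\<^sub>R a + b) (n *\<^sub>R a - c) = - t * sq_P a c - sq_P b c"
    by (simp add: sq_P_lincomb null orth)
  then have "2 * sq0 (q t n) = 2 * (- t * sq_P a c - sq_P b c) / sq_I b"
    using Ib by (simp add: q_def sq0_inverse_mult u)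
  then have "2 * sq0 (q t n) = t \<longleftrightarrow> t * (sq_I b + 2 * sq_P a c) = - 2 * sq_P b c"
    using Ib by (auto simp: divide_eq_eq algebra_simps)
  then show "2 * sq0 (q t n) = t \<longleftrightarrow> t = (- 2 * sq_P b c) / (sq_I b + 2 * sq_P a c)"
    using denom by (simp only: eq_divide_eq simp_thms if_True)
qed

theorem theorem4p2:
  fixes a b c :: split_quat and a2 a3 b1 b2 b3 T N :: real
  assumes a: "a = 1 + a2 *\<^sub>R sq_j + a3 *\<^sub>R sq_k" and a_norm: "a2\<^sup>2 + a3\<^sup>2 = 1"
    and b: "b = b1 *\<^sub>R sq_i + b2 *\<^sub>R sq_j + b3 *\<^sub>R sq_k" and b_nz: "b \<noteq> 0"
    and P_ab: "sq_P a b = 0"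
    and I_b: "sq_I b \<noteq> 0"
    and denom: "sq_I b + 2 * sq_P a c \<noteq> 0"
    and N: "N = sq_I c / (sq_I b + 2 * sq_P a c)"
    and T: "T = (- 2 * sq_P b c) / (sq_I b + 2 * sq_P a c)"
  shows "(\<exists>x. a * x\<^sup>2 + b * x + c = 0)
    \<and> sq_invertible (T *\<^sub>R a + b)
    \<and> (\<forall>x. a * x\<^sup>2 + b * x + c = 0 \<longleftrightarrow> x = sq_inverse (T *\<^sub>R a + b) * (N *\<^sub>R a - c))"
proof -
  have null: "sq_I a = 0"
    using a_norm
    by (simp add: a sq_I_def sq_j_def sq_k_def one_split_quat_def plus_split_quat_def
        scaleR_split_quat_def)
  let ?q = "\<lambda>t n. sq_inverse (t *\<^sub>R a + b) * (n *\<^sub>R a - c)"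
  note consistent = norm_trace_consistent_iff[OF null P_ab I_b denom]
  have sol: "a * x\<^sup>2 + b * x + c = 0 \<longleftrightarrow> x = ?q T N" for x
  proof
    assume "a * x\<^sup>2 + b * x + c = 0"
    then have x: "x = ?q (2 * sq0 x) (sq_I x)"
      by (simp add: quadratic_iff_quotient[OF null P_ab I_b])
    have "sq_I x = N"
      using consistent(1)[of "2 * sq0 x" "sq_I x"] x N by simp
    moreover have "2 * sq0 x = T"
      using consistent(2)[of "2 * sq0 x" "sq_I x"] x T by simp
    ultimately show "x = ?q T N"
      using x by simp
  next
    assume x: "x = ?q T N"
    have "sq_I x = N" "2 * sq0 x = T"
      using consistent(1)[of T N] consistent(2)[of T N] x N T by simp_all
    then show "a * x\<^sup>2 + b * x + c = 0"
      using x by (simp add: quadratic_iff_quotient[OF null P_ab I_b])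
  qed
  have "sq_invertible (T *\<^sub>R a + b)"
    using I_b by (intro sq_invertible_if_norm_nonzero) (simp add: sq_I_scaleR_null_add null P_ab)
  with sol show ?thesis
    by blast
qed

end
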